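(* For all $t\in(0,\pi/2)$, $$\cos^{2/3}t<\frac23\cos t+\frac13<\left(\cos\frac{2t}{3}\right)^{3/2}$$ and $$\left(\cos\frac t2\right)^{4/3}<\frac{\sin t}{t}<\frac{2\cos\frac t2+\cos^2\frac t2}{3}<\left(\frac23\cos\frac t2+\frac13\right)^2<\cos^3\frac t3.$$ *)

theory Defs
  imports Complex_Main
begin

end

(* By AM-GM, 3 p^2 < 2 p^3 + 1 for p > 0, p \<noteq> 1. With p^3 = cos t this is the first bound; with
   p^3 = (cos x)^2 it shows that sin x / (cos x)^(1/3) - x increases, which at x = t / 2 is the lower
   bound for sin t / t. The first upper bound for sin t / t is the Cusa-Huygens inequality at t / 2.
   The comparisons with cos (2 t / 3) and cos (t / 3) are one inequality, at w = t / 3 and w = t / 6: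
   in terms of u = cos w it is polynomial, with a double root at u = 1. *)
theory Submission
  imports Defs
begin

lemma three_square_less_two_cube_plus_one:
  fixes x :: real
  assumes "0 < x" "x \<noteq> 1"
  shows "3 * x\<^sup>2 < 2 * x ^ 3 + 1"
proof -
  have "2 * x ^ 3 + 1 - 3 * x\<^sup>2 = (x - 1)\<^sup>2 * (2 * x + 1)"
    by (simp add: power2_eq_square power3_eq_cube algebra_simps)
  moreover have "(x - 1)\<^sup>2 * (2 * x + 1) > 0"
    using assms by (intro mult_pos_pos) auto
  ultimately show ?thesis by linarith
qed

lemma cos_strictly_between_0_1:
  fixes x :: real
  assumes "0 < x" "x < pi / 2"
  shows "0 < cos x" "cos x < 1"
  using assms cos_gt_zero[of x] cos_monotone_0_pi[of 0 x] by auto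

lemma powr_two_thirds_less:
  fixes c :: real
  assumes "0 < c" "c \<noteq> 1"
  shows "c powr (2 / 3) < 2 / 3 * c + 1 / 3"
proof -
  define p where "p = c powr (1 / 3)"
  have "p > 0" using assms by (simp add: p_def)
  have "p ^ 3 = c" using assms by (simp add: p_def powr_power)
  moreover have "p\<^sup>2 = c powr (2 / 3)" using assms by (simp add: p_def powr_power)
  moreover have "p \<noteq> 1" using \<open>p ^ 3 = c\<close> \<open>c \<noteq> 1\<close> by auto
  ultimately show ?thesis
    using three_square_less_two_cube_plus_one[OF \<open>p > 0\<close>] by simp
qed

lemma cos_triple_bound:
  fixes w :: real
  assumes "0 < w" "w < pi / 6"
  shows "(2 / 3 * cos (3 * w) + 1 / 3)\<^sup>2 < cos (2 * w) ^ 3"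
proof -
  define u where "u = cos w"
  have "u < 1" using assms cos_strictly_between_0_1[of w] by (simp add: u_def)
  \<comment> \<open>The range \<open>w < pi / 6\<close> is what \<open>w = t / 3\<close> covers for
    \<open>t < pi / 2\<close>. It gives \<open>u > sqrt 3 / 2\<close>, weakened here to the rational
    bound \<open>4 / 5\<close>.\<close>
  have "cos (pi / 6) < u" using assms cos_monotone_0_pi[of w "pi / 6"] by (simp add: u_def)
  moreover have "8 / 5 < sqrt (3 :: real)" by (rule real_less_rsqrt) (simp add: power2_eq_square)
  ultimately have u: "4 / 5 < u" by (simp add: cos_30)
  \<comment> \<open>In the quartic below, the three positive terms at \<open>4 / 5\<close> already
    add up to 9.5744, while \<open>u < 1\<close> keeps \<open>4 * u + 5\<close> below 9.\<close>
  have "(4 / 5) ^ 2 < u ^ 2" "(4 / 5) ^ 3 < u ^ 3" "(4 / 5) ^ 4 < u ^ 4"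
    using u by (intro power_strict_mono; simp)+
  with \<open>u < 1\<close> have "0 < 4 * u ^ 4 + 8 * u ^ 3 + 6 * u ^ 2 - 4 * u - 5"
    by (simp add: power_divide)
  with \<open>u < 1\<close> have "0 < (u - 1)\<^sup>2 * (4 * u ^ 4 + 8 * u ^ 3 + 6 * u ^ 2 - 4 * u - 5)"
    by (intro mult_pos_pos) auto
  \<comment> \<open>The factor \<open>9 / 2\<close> makes the coefficients of the quartic cofactor
    of \<open>(u - 1)\<^sup>2\<close> integers.\<close>
  also have "\<dots> = 9 / 2 * ((2 * u\<^sup>2 - 1) ^ 3 - (2 / 3 * (4 * u ^ 3 - 3 * u) + 1 / 3)\<^sup>2)"
    by (simp add: power_numeral_reduce field_simps)
  finally show ?thesis
    by (simp add: cos_double_cos cos_treble_cos flip: u_def)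
qed

text \<open>The difference vanishes at 0 and has derivative \<open>y * sin y\<close>. This is
  \<open>x < tan x\<close> freed of the division, so it also holds beyond \<open>pi / 2\<close>; it
  supplies the sign of the derivative in \<open>Cusa_Huygens\<close>.\<close>

lemma x_cos_less_sin:
  fixes x :: real
  assumes "0 < x" "x < pi"
  shows "x * cos x < sin x"
proof -
  let ?f = "\<lambda>y :: real. sin y - y * cos y"
  have "?f 0 < ?f x"
  proof (rule DERIV_pos_imp_increasing_open[OF \<open>0 < x\<close>])
    fix y assume y: "0 < y" "y < x"
    have "(?f has_real_derivative y * sin y) (at y)"
      by (auto intro!: derivative_eq_intros)
    moreover have "0 < y * sin y" using y assms by (simp add: sin_gt_zero)
    ultimately show "\<exists>d. (?f has_real_derivative d) (at y) \<and> 0 < d" by blast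
  qed (intro continuous_intros)
  then show ?thesis by simp
qed

text \<open>The difference of the two sides vanishes at 0. Half-angle formulas make its derivative a
  positive multiple of \<open>sin (y / 2) - y / 2 * cos (y / 2)\<close>, which is positive by
  \<open>x_cos_less_sin\<close>.\<close>

lemma Cusa_Huygens:
  fixes x :: real
  assumes "0 < x" "x < pi"
  shows "3 * sin x < x * (2 + cos x)"
proof -
  let ?f = "\<lambda>y :: real. y * (2 + cos y) - 3 * sin y"
  have "?f 0 < ?f x"
  proof (rule DERIV_pos_imp_increasing_open[OF \<open>0 < x\<close>])
    fix y assume y: "0 < y" "y < x"
    have "(?f has_real_derivative 2 + cos y - y * sin y - 3 * cos y) (at y)"
      by (auto intro!: derivative_eq_intros)
    moreover have "2 + cos y - y * sin y - 3 * cos y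
        = 4 * sin (y / 2) * (sin (y / 2) - y / 2 * cos (y / 2))"
    proof -
      have "cos y = 1 - 2 * (sin (y / 2))\<^sup>2" "sin y = 2 * sin (y / 2) * cos (y / 2)"
        using cos_double_sin[of "y / 2"] sin_double[of "y / 2"] by simp_all
      then show ?thesis by (simp add: power2_eq_square algebra_simps)
    qed
    moreover have "0 < 4 * sin (y / 2) * (sin (y / 2) - y / 2 * cos (y / 2))"
      using y assms x_cos_less_sin[of "y / 2"] by (intro mult_pos_pos) (auto intro: sin_gt_zero)
    ultimately show "\<exists>d. (?f has_real_derivative d) (at y) \<and> 0 < d" by metis
  qed (intro continuous_intros)
  then show ?thesis by simp
qed

lemma Adamovic_Mitrinovic:
  fixes x :: real
  assumes "0 < x" "x < pi / 2"
  shows "x * cos x powr (1 / 3) < sin x"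
proof -
  let ?f = "\<lambda>y :: real. sin y * cos y powr (- 1 / 3) - y"
  have "?f 0 < ?f x"
  proof (rule DERIV_pos_imp_increasing_open[OF \<open>0 < x\<close>])
    fix y assume y: "0 < y" "y < x"
    \<comment> \<open>In terms of the cube root \<open>p\<close> of \<open>cos y\<close> the
      derivative is rational: \<open>p\<^sup>2 + (1 - p ^ 6) / (3 * p ^ 4) - 1\<close>. Over the
      common denominator its numerator is the AM-GM difference at \<open>p\<^sup>2\<close>.\<close>
    define c p where "c = cos y" and "p = c powr (1 / 3)"
    have c: "0 < c" "c < 1" using y assms cos_strictly_between_0_1[of y] by (auto simp: c_def)
    have p: "0 < p" "p ^ 3 = c" using c by (simp_all add: p_def powr_power)
    have "p \<noteq> 1" using p c by auto
    have pows: "c powr (- 1 / 3) = 1 / p" "c powr (- 4 / 3) = 1 / p ^ 4"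
      using c powr_minus_divide[of c "1 / 3"] powr_minus_divide[of c "4 / 3"]
      by (simp_all add: p_def powr_power)
    have "(?f has_real_derivative
            cos y * cos y powr (- 1 / 3) + sin y * ((- 1 / 3) * cos y powr (- 4 / 3) * - sin y) - 1)
          (at y)"
      using c unfolding c_def by (auto intro!: derivative_eq_intros)
    moreover have "cos y * cos y powr (- 1 / 3)
        + sin y * ((- 1 / 3) * cos y powr (- 4 / 3) * - sin y) - 1
        = (2 * (p\<^sup>2) ^ 3 + 1 - 3 * (p\<^sup>2)\<^sup>2) / (3 * p ^ 4)"
    proof -
      have "sin y * ((- 1 / 3) * cos y powr (- 4 / 3) * - sin y) = (1 - c\<^sup>2) / (3 * p ^ 4)"
        using pows(2) sin_squared_eq[of y] by (simp add: c_def power2_eq_square)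
      moreover have "cos y * cos y powr (- 1 / 3) = p\<^sup>2"
        using pows(1) p by (simp add: power2_eq_square power3_eq_cube flip: c_def p(2))
      ultimately show ?thesis
        using p(1) unfolding p(2)[symmetric] by (simp add: field_simps)
    qed
    moreover have "0 < (2 * (p\<^sup>2) ^ 3 + 1 - 3 * (p\<^sup>2)\<^sup>2) / (3 * p ^ 4)"
      using three_square_less_two_cube_plus_one[of "p\<^sup>2"] p(1) \<open>p \<noteq> 1\<close>
      by (simp add: power2_eq_1_iff)
    ultimately show "\<exists>d. (?f has_real_derivative d) (at y) \<and> 0 < d"
      by (intro exI conjI) (assumption, simp only:)
  next
    \<comment> \<open>Continuity of \<open>powr\<close> asks for a nonzero base on the closed
      interval; as this includes 0, positivity of \<open>cos\<close> is taken from the symmetric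
      range around 0.\<close>
    have "0 < cos y" if "y \<in> {0..x}" for y
      using that assms by (intro cos_gt_zero_pi) auto
    then show "continuous_on {0..x} ?f"
      by (intro continuous_intros ballI) (simp add: less_imp_neq[symmetric])
  qed
  moreover have "0 < cos x" using assms cos_strictly_between_0_1(1) by blast
  ultimately show ?thesis
    using powr_minus_divide[of "cos x" "1 / 3"] by (simp add: field_simps)
qed

theorem theorem3:
  fixes t :: real
  assumes "t \<in> {0<..<pi / 2}"
  shows "(cos t powr (2 / 3) < 2 / 3 * cos t + 1 / 3 \<and>
          2 / 3 * cos t + 1 / 3 < cos (2 * t / 3) powr (3 / 2)) \<and>
         (cos (t / 2) powr (4 / 3) < sin t / t \<and>
          sin t / t < (2 * cos (t / 2) + (cos (t / 2))\<^sup>2) / 3 \<and>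
          (2 * cos (t / 2) + (cos (t / 2))\<^sup>2) / 3 < (2 / 3 * cos (t / 2) + 1 / 3)\<^sup>2 \<and>
          (2 / 3 * cos (t / 2) + 1 / 3)\<^sup>2 < cos (t / 3) ^ 3)"
proof -
  have t: "0 < t" "t < pi / 2" using assms by auto
  define c where "c = cos (t / 2)"
  have c: "0 < c" "c < 1"
    using t cos_strictly_between_0_1[of "t / 2"] by (simp_all add: c_def)
  \<comment> \<open>A factor \<open>c\<close> splits off from \<open>sin t / t\<close> and from both
    of its nearest bounds, which leaves bounds for \<open>sin (t / 2) / (t / 2)\<close>:
    \<open>c powr (1 / 3)\<close> below and \<open>(2 + c) / 3\<close> above.\<close>
  have sin_t: "sin t = 2 * sin (t / 2) * c"
    using sin_double[of "t / 2"] by (simp add: c_def)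
  have "cos t powr (2 / 3) < 2 / 3 * cos t + 1 / 3"
    using powr_two_thirds_less[of "cos t"] cos_strictly_between_0_1[OF t] by simp
  \<comment> \<open>Squaring turns the exponent \<open>3 / 2\<close> into a cube, the form of
    \<open>cos_triple_bound\<close>; for this only the right side has to be nonnegative.\<close>
  moreover have "2 / 3 * cos t + 1 / 3 < cos (2 * t / 3) powr (3 / 2)"
  proof (rule power2_less_imp_less)
    have "0 < cos (2 * t / 3)" using t by (intro cos_gt_zero) auto
    then have "(cos (2 * t / 3) powr (3 / 2))\<^sup>2 = cos (2 * t / 3) ^ 3"
      by (simp add: powr_power)
    then show "(2 / 3 * cos t + 1 / 3)\<^sup>2 < (cos (2 * t / 3) powr (3 / 2))\<^sup>2"
      using cos_triple_bound[of "t / 3"] t by simp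
  qed simp
  moreover have "c powr (4 / 3) < sin t / t"
  proof -
    have "c powr (4 / 3) = c * c powr (1 / 3)"
      using c powr_add[of c 1 "1 / 3"] by simp
    moreover have "t / 2 * c powr (1 / 3) < sin (t / 2)"
      using Adamovic_Mitrinovic[of "t / 2"] t by (simp add: c_def)
    then have "c * (t * c powr (1 / 3)) < c * (2 * sin (t / 2))"
      using c by (intro mult_strict_left_mono) auto
    ultimately show ?thesis
      using t by (simp add: sin_t pos_less_divide_eq mult_ac)
  qed
  moreover have "sin t / t < (2 * c + c\<^sup>2) / 3"
  proof -
    have "3 * sin (t / 2) < t / 2 * (2 + c)"
      using Cusa_Huygens[of "t / 2"] t by (simp add: c_def)
    then have "2 * c * (3 * sin (t / 2)) < 2 * c * (t / 2 * (2 + c))"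
      using c by (intro mult_strict_left_mono) auto
    then show ?thesis
      using t by (simp add: sin_t field_simps power2_eq_square)
  qed
  moreover have "(2 * c + c\<^sup>2) / 3 < (2 / 3 * c + 1 / 3)\<^sup>2"
  proof -
    have "(2 / 3 * c + 1 / 3)\<^sup>2 - (2 * c + c\<^sup>2) / 3 = (1 - c)\<^sup>2 / 9"
      by (simp add: power2_eq_square field_simps)
    moreover have "(1 - c)\<^sup>2 / 9 > 0" using c by simp
    ultimately show ?thesis by linarith
  qed
  moreover have "(2 / 3 * c + 1 / 3)\<^sup>2 < cos (t / 3) ^ 3"
    using cos_triple_bound[of "t / 6"] t by (simp add: c_def)
  ultimately show ?thesis
    unfolding c_def by blast
qed

end
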